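(* Let $K\subset\mathbb{R}^m$ be a strictly convex body. There exists a continuous map $f_K\colon \mathbb{R}\mathrm{P}^m\longrightarrow S^m$ with the following property for every integer $k\geq 2$: if $f_K$ admits a $k$-multiplicity, then there exist $k$ pairwise distinct affine diameters $\ell_1+v_1,\ldots,\ell_k+v_k$ of $K$ such that \[ (\ell_1+v_1)\cap\cdots\cap(\ell_k+v_k)\cap\operatorname{int}K\neq\emptyset . \]
   Context: A convex body in $\mathbb{R}^m$ is a convex compact subset with non-empty interior. An affine diameter of a convex body $K\subset\mathbb{R}^m$ in direction $\ell\in\mathbb{R}\mathrm{P}^{m-1}$ (a line through the origin) is any affine line $\ell+v$, $v\in\mathbb{R}^m$, with \[ \operatorname{length}(K\cap(\ell+v))=\max\{\operatorname{length}(K\cap(\ell+u)) : u\in\mathbb{R}^m\}, \] where $\operatorname{length}$ denotes the length of an interval. An affine diameter of $K$ is an affine diameter in some direction. A continuous map $f\colon M\to N$ admits a $k$-multiplicity if there exist $k$ pairwise distinct points $x_1,\ldots,x_k\in M$ with $f(x_1)=\cdots=f(x_k)$. *)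

theory Defs
  imports "HOL-Analysis.Analysis"
begin

definition convex_body :: "'a::euclidean_space set \<Rightarrow> bool" where
  "convex_body K \<longleftrightarrow> convex K \<and> compact K \<and> interior K \<noteq> {}"

definition strictly_convex_body :: "'a::euclidean_space set \<Rightarrow> bool" where
  "strictly_convex_body K \<longleftrightarrow>
     convex_body K \<and>
     (\<forall>x\<in>K. \<forall>y\<in>K. x \<noteq> y \<longrightarrow> open_segment x y \<subseteq> interior K)"

(* The points of the projective space P(V) of V = 'a are the lines through the origin of V, so
   P(V) is RP^(d-1) for d = DIM('a).  Its topology is the quotient topology of the unit sphere
   S^(d-1) under x |-> span {x}. *)
definition lines_through_origin :: "'a::euclidean_space set set" where
  "lines_through_origin = {L. subspace L \<and> dim L = 1}"

definition real_projective_space :: "'a::euclidean_space set topology" where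
  "real_projective_space = topology (\<lambda>U.
     U \<subseteq> lines_through_origin \<and>
     openin (top_of_set (sphere 0 1)) {x \<in> sphere 0 1. span {x} \<in> U})"

lemma lines_through_origin_eq_image_sphere:
  "(lines_through_origin :: 'a::euclidean_space set set) = (\<lambda>x. span {x}) ` sphere 0 1"
proof (intro equalityI subsetI)
  fix L :: "'a set"
  assume "L \<in> lines_through_origin"
  then have L: "subspace L" "dim L = 1" by (auto simp: lines_through_origin_def)
  then obtain x where x: "x \<in> L" "x \<noteq> 0"
    by (metis dim_eq_0 one_neq_zero subsetI singleton_iff)
  define u where "u = x /\<^sub>R norm x"
  have u: "u \<in> L" "norm u = 1" using x L by (auto simp: u_def subspace_scale)
  then have "dim {u} = 1" by (subst dim_eq_card_independent) auto
  then have "span {u} = L"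
    using u L by (intro subspace_dim_equal) (auto simp: span_minimal dim_span)
  then show "L \<in> (\<lambda>x. span {x}) ` sphere 0 1" using u by force
next
  fix L :: "'a set"
  assume "L \<in> (\<lambda>x. span {x}) ` sphere 0 1"
  then obtain x :: 'a where x: "norm x = 1" "L = span {x}" by auto
  then have "dim {x} = 1" by (subst dim_eq_card_independent) auto
  then show "L \<in> lines_through_origin"
    using x by (simp add: lines_through_origin_def dim_span)
qed

lemma openin_real_projective_space:
  "openin (real_projective_space :: 'a::euclidean_space set topology) U \<longleftrightarrow>
     U \<subseteq> lines_through_origin \<and>
     openin (top_of_set (sphere 0 1)) {x \<in> sphere 0 1. span {x} \<in> U}"
proof -
  let ?S = "sphere 0 1 :: 'a set"
  let ?P = "\<lambda>U. U \<subseteq> lines_through_origin \<and> openin (top_of_set ?S) {x \<in> ?S. span {x} \<in> U}"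
  have "istopology ?P"
    unfolding istopology_def
  proof (intro conjI allI impI)
    fix A B assume A: "?P A" and B: "?P B"
    have "{x \<in> ?S. span {x} \<in> A \<inter> B} = {x \<in> ?S. span {x} \<in> A} \<inter> {x \<in> ?S. span {x} \<in> B}"
      by auto
    then show "openin (top_of_set ?S) {x \<in> ?S. span {x} \<in> A \<inter> B}"
      using A B by (simp add: openin_Int)
    show "A \<inter> B \<subseteq> lines_through_origin" using A by auto
  next
    fix \<K> assume K: "\<forall>A\<in>\<K>. ?P A"
    have "{x \<in> ?S. span {x} \<in> \<Union>\<K>} = (\<Union>A\<in>\<K>. {x \<in> ?S. span {x} \<in> A})" by auto
    moreover have "openin (top_of_set ?S) (\<Union>A\<in>\<K>. {x \<in> ?S. span {x} \<in> A})"
      using K by (intro openin_clauses(3)) auto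
    ultimately show "openin (top_of_set ?S) {x \<in> ?S. span {x} \<in> \<Union>\<K>}" by simp
    show "\<Union>\<K> \<subseteq> lines_through_origin" using K by auto
  qed
  then show ?thesis by (simp add: real_projective_space_def)
qed

lemma topspace_real_projective_space [simp]:
  "topspace (real_projective_space :: 'a::euclidean_space set topology) = lines_through_origin"
proof
  have *: "{x \<in> sphere 0 1. span {x} \<in> lines_through_origin} = (sphere 0 1 :: 'a set)"
    unfolding lines_through_origin_eq_image_sphere by auto
  show "topspace (real_projective_space :: 'a set topology) \<subseteq> lines_through_origin"
    using openin_real_projective_space openin_topspace by blast
  show "lines_through_origin \<subseteq> topspace (real_projective_space :: 'a set topology)"
    by (intro openin_subset) (simp only: openin_real_projective_space *, simp)
qed

lemma quotient_map_real_projective_space: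
  "quotient_map (top_of_set (sphere 0 1))
     (real_projective_space :: 'a::euclidean_space set topology) (\<lambda>x. span {x})"
  unfolding quotient_map_def
  by (auto simp: lines_through_origin_eq_image_sphere[symmetric] openin_real_projective_space)

(* Only applied to intersections of a compact convex set with a line, i.e. to compact (possibly
   degenerate or empty) intervals; there the diameter is the length. *)
definition interval_length :: "'a::euclidean_space set \<Rightarrow> real" where
  "interval_length I = diameter I"

lemma interval_length_empty: "interval_length {} = 0"
  by (simp add: interval_length_def)

lemma interval_length_closed_segment: "interval_length (closed_segment a b) = dist a b"
proof -
  have "diameter (closed_segment a b) \<le> dist a b"
  proof (rule diameter_le)
    fix x y assume "x \<in> closed_segment a b" "y \<in> closed_segment a b"
    then obtain s t where st: "0 \<le> s" "s \<le> 1" "0 \<le> t" "t \<le> 1"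
      and xy: "x = (1 - s) *\<^sub>R a + s *\<^sub>R b" "y = (1 - t) *\<^sub>R a + t *\<^sub>R b"
      by (auto simp: closed_segment_def)
    have "x - y = (t - s) *\<^sub>R (a - b)" unfolding xy by (simp add: algebra_simps)
    then have "norm (x - y) = \<bar>t - s\<bar> * dist a b" by (simp add: dist_norm)
    also have "\<dots> \<le> dist a b" using st by (intro mult_left_le_one_le) auto
    finally show "norm (x - y) \<le> dist a b" .
  qed auto
  moreover have "dist a b \<le> diameter (closed_segment a b)"
    by (rule diameter_bounded_bound) (auto intro: compact_imp_bounded)
  ultimately show ?thesis by (simp add: interval_length_def)
qed

(* A is an affine diameter l + v of K in the direction l *)
definition affine_diameter_in_direction ::
    "'a::euclidean_space set \<Rightarrow> 'a set \<Rightarrow> 'a set \<Rightarrow> bool" where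
  "affine_diameter_in_direction K l A \<longleftrightarrow>
     l \<in> topspace real_projective_space \<and>
     (\<exists>v. A = (+) v ` l \<and>
          (\<forall>u. interval_length (K \<inter> (+) u ` l) \<le> interval_length (K \<inter> (+) v ` l)))"

definition affine_diameter :: "'a::euclidean_space set \<Rightarrow> 'a set \<Rightarrow> bool" where
  "affine_diameter K A \<longleftrightarrow> (\<exists>l. affine_diameter_in_direction K l A)"

definition admits_multiplicity :: "'a topology \<Rightarrow> ('a \<Rightarrow> 'b) \<Rightarrow> nat \<Rightarrow> bool" where
  "admits_multiplicity M f k \<longleftrightarrow>
     (\<exists>x :: nat \<Rightarrow> 'a. x ` {1..k} \<subseteq> topspace M \<and> inj_on x {1..k} \<and>
        (\<forall>i\<in>{1..k}. \<forall>j\<in>{1..k}. f (x i) = f (x j)))"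

end

theory Submission
  imports Defs
begin

text \<open>
  \<open>RP\<^sup>m\<close> is the Thom space of the tautological line bundle over \<open>RP\<^sup>m\<^sup>-\<^sup>1\<close>, and \<open>K / \<partial>K\<close> is the sphere
  \<open>S\<^sup>m\<close>. By strict convexity there is exactly one affine diameter in each direction, and it depends
  continuously on the direction; so the disc bundle is mapped to \<open>K\<close> by sending the fibre over a line
  \<open>l\<close> affinely onto the chord that the affine diameter in direction \<open>l\<close> cuts out of \<open>K\<close>. The sphere
  bundle goes to \<open>\<partial>K\<close>, and collapsing both gives \<open>f\<close>. The point at infinity of the Thom space is the
  only point over the class of \<open>\<partial>K\<close>, so every multiplicity of \<open>f\<close> occurs at a point of the interior
  of \<open>K\<close>, where it is a concurrency of affine diameters.
\<close>

section \<open>Collapsing the boundary of a convex body to a point of the sphere\<close>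

text \<open>With \<open>norm z = sin a\<close>, the image has height \<open>- cos (2 * a)\<close>
  and distance \<open>sin (2 * a)\<close> from the axis, so each radius of the unit ball runs along
  a half meridian from the pole \<open>(0, -1)\<close> to the pole \<open>(0, 1)\<close>.\<close>

definition ball_collapse :: "'a::euclidean_space \<Rightarrow> 'a \<times> real" where
  "ball_collapse z = ((2 * sqrt (1 - (norm z)\<^sup>2)) *\<^sub>R z, 2 * (norm z)\<^sup>2 - 1)"

text \<open>The height determines \<open>norm z\<close>. Where \<open>norm z < 1\<close> the factor
  in front of \<open>z\<close> is nonzero, so \<open>z\<close> itself is recovered; height 1 forces
  \<open>norm z = 1\<close>, where that factor vanishes.\<close>

lemma ball_collapse:
  shows continuous_on_ball_collapse: "continuous_on (cball 0 1) (ball_collapse :: 'a::euclidean_space \<Rightarrow> _)"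
    and ball_collapse_in_sphere: "ball_collapse ` cball (0 :: 'a) 1 \<subseteq> sphere 0 1"
    and ball_collapse_eq_pole_iff:
      "\<And>z :: 'a. z \<in> cball 0 1 \<Longrightarrow> ball_collapse z = (0, 1) \<longleftrightarrow> z \<in> sphere 0 1"
    and inj_on_ball_collapse: "inj_on ball_collapse (ball (0 :: 'a) 1)"
proof -
  let ?c = "ball_collapse :: 'a \<Rightarrow> 'a \<times> real"
  show "continuous_on (cball 0 1) ?c"
    unfolding ball_collapse_def by (intro continuous_intros)
  show "?c ` cball 0 1 \<subseteq> sphere 0 1"
  proof (rule image_subsetI)
    fix z :: 'a assume "z \<in> cball 0 1"
    then have "(norm z)\<^sup>2 \<le> 1" by (simp add: power_le_one)
    then have "(norm (?c z))\<^sup>2 = 4 * (1 - (norm z)\<^sup>2) * (norm z)\<^sup>2 + (2 * (norm z)\<^sup>2 - 1)\<^sup>2"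
      by (simp add: ball_collapse_def norm_Pair power_mult_distrib)
    also have "\<dots> = 1" by (simp add: power2_eq_square algebra_simps)
    finally show "?c z \<in> sphere 0 1" using norm_ge_zero[of "?c z"] by (simp add: power2_eq_1_iff del: norm_ge_zero)
  qed
  show "?c z = (0, 1) \<longleftrightarrow> z \<in> sphere 0 1" if "z \<in> cball 0 1" for z
    using norm_ge_zero[of z] by (auto simp: ball_collapse_def power2_eq_1_iff simp del: norm_ge_zero)
  show "inj_on ?c (ball 0 1)"
  proof (rule inj_onI)
    fix y z :: 'a assume yz: "y \<in> ball 0 1" "z \<in> ball 0 1" "?c y = ?c z"
    then have n: "(norm y)\<^sup>2 = (norm z)\<^sup>2" by (simp add: ball_collapse_def)
    moreover have "(norm z)\<^sup>2 < 1" using yz by (simp add: abs_square_less_1)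
    ultimately show "y = z" using yz by (simp add: ball_collapse_def)
  qed
qed

text \<open>Invariance of domain, applied to a homeomorphism of \<open>K\<close> onto the unit ball
  and to its inverse, shows that it matches \<open>interior K\<close> with the open ball. Composing
  it with \<open>ball_collapse\<close> then gives a model of the quotient
  \<open>K / frontier K\<close>.\<close>

lemma collapse_frontier:
  fixes K :: "'a::euclidean_space set"
  assumes "convex_body K"
  obtains q :: "'a \<Rightarrow> 'a \<times> real"
  where "continuous_on K q" "q ` K \<subseteq> sphere 0 1" "inj_on q (interior K)"
    and "\<And>y. y \<in> K \<Longrightarrow> q y = (0, 1) \<longleftrightarrow> y \<notin> interior K"
proof -
  have K: "convex K" "compact K" "interior K \<noteq> {}"
    using assms by (auto simp: convex_body_def)
  obtain g h where gh: "homeomorphism K (cball (0::'a) 1) g h"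
    using homeomorphic_convex_compact_cball[OF K, of 1 0] by (auto simp: homeomorphic_def)
  then have g: "continuous_on K g" "\<And>x. x \<in> K \<Longrightarrow> g x \<in> cball 0 1" "\<And>x. x \<in> K \<Longrightarrow> h (g x) = x"
    and h: "continuous_on (cball 0 1) h" "\<And>x. x \<in> cball 0 1 \<Longrightarrow> h x \<in> K"
      "\<And>x. x \<in> cball 0 1 \<Longrightarrow> g (h x) = x"
    unfolding homeomorphism_def by blast+
  have inj_g: "inj_on g K" using g(3) by (rule inj_on_inverseI)
  have inj_h: "inj_on h (cball 0 1)" using h(3) by (rule inj_on_inverseI)
  have "open (g ` interior K)"
    by (rule invariance_of_domain[OF continuous_on_subset[OF g(1) interior_subset] open_interior
          inj_on_subset[OF inj_g interior_subset]])
  moreover have "g ` interior K \<subseteq> cball 0 1"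
    using g(2) interior_subset by (meson image_subsetI subsetD)
  ultimately have g_int: "g ` interior K \<subseteq> ball 0 1"
    using interior_maximal[of "g ` interior K" "cball 0 1"] by (simp add: interior_cball)
  have "open (h ` ball 0 1)"
    by (rule invariance_of_domain[OF continuous_on_subset[OF h(1) ball_subset_cball] open_ball
          inj_on_subset[OF inj_h ball_subset_cball]])
  moreover have "h ` ball 0 1 \<subseteq> K"
    using h(2) ball_subset_cball by (meson image_subsetI subsetD)
  ultimately have h_int: "h ` ball 0 1 \<subseteq> interior K" by (rule interior_maximal[rotated])
  show thesis
  proof
    show "continuous_on K (ball_collapse \<circ> g)"
      using g(2) by (intro continuous_on_compose g(1) continuous_on_subset[OF continuous_on_ball_collapse]) (rule image_subsetI)
    show "(ball_collapse \<circ> g) ` K \<subseteq> sphere 0 1"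
      using g(2) ball_collapse_in_sphere unfolding o_def by blast
    show "inj_on (ball_collapse \<circ> g) (interior K)"
      by (intro comp_inj_on inj_on_subset[OF inj_g interior_subset] inj_on_subset[OF inj_on_ball_collapse g_int])
    show "(ball_collapse \<circ> g) y = (0, 1) \<longleftrightarrow> y \<notin> interior K" if "y \<in> K" for y
    proof -
      have gy: "g y \<in> cball 0 1" "h (g y) = y" using g that by auto
      have "y \<in> interior K \<longleftrightarrow> g y \<in> ball 0 1"
        using g_int h_int gy by (metis image_subset_iff)
      then show ?thesis using ball_collapse_eq_pole_iff[OF gy(1)] gy(1) by auto
    qed
  qed
qed

section \<open>Longest chords and the difference body\<close>

text \<open>Translating the open set \<open>interior S\<close> by a single \<open>y\<close> stays
  among the differences. Hence a pair in \<open>K\<close> whose difference lies on the frontier of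
  \<open>K - K\<close> must start outside \<open>interior K\<close>.\<close>

lemma interior_differences:
  fixes S T :: "'a::euclidean_space set"
  assumes "x \<in> interior S" "y \<in> T"
  shows "x - y \<in> interior {x - y |x y. x \<in> S \<and> y \<in> T}"
proof -
  have "open ((\<lambda>x. x - y) ` interior S)"
    by (rule open_translation_subtract) simp
  moreover have "(\<lambda>x. x - y) ` interior S \<subseteq> {x - y |x y. x \<in> S \<and> y \<in> T}"
    using assms interior_subset by blast
  ultimately have "(\<lambda>x. x - y) ` interior S \<subseteq> interior {x - y |x y. x \<in> S \<and> y \<in> T}"
    by (rule interior_maximal[rotated])
  then show ?thesis using assms(1) by blast
qed

text \<open>If \<open>s\<close> exceeded \<open>r\<close>, the frontier point would arise from a
  point of \<open>D\<close> by a proper shrinking towards the interior point 0, which makes it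
  interior.\<close>

lemma frontier_maximal_on_ray:
  fixes D :: "'a::euclidean_space set"
  assumes "convex D" "closed D" "0 \<in> interior D"
    and "r > 0" "r *\<^sub>R u \<in> frontier D" "s *\<^sub>R u \<in> D"
  shows "s \<le> r"
proof (rule ccontr)
  assume "\<not> s \<le> r"
  then have s: "r < s" by simp
  define t where "t = 1 - r / s"
  have t: "0 < t" "t \<le> 1" using s assms(4) by (auto simp: t_def)
  have "s *\<^sub>R u - t *\<^sub>R (s *\<^sub>R u - 0) \<in> interior D"
    by (rule mem_interior_convex_shrink) (use assms t in auto)
  moreover have "s *\<^sub>R u - t *\<^sub>R (s *\<^sub>R u - 0) = r *\<^sub>R u"
    using s assms(4) by (simp add: t_def algebra_simps)
  ultimately show False using assms(5) by (simp add: frontier_def)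
qed

text \<open>The affine diameter in direction \<open>u\<close> has the endpoints \<open>Y u\<close> and \<open>Y (- u)\<close>: these are the points
  of \<open>K\<close> whose difference lies on the frontier of the difference body \<open>K - K\<close>.\<close>

lemma affine_diameter_endpoints:
  fixes K :: "'a::euclidean_space set"
  assumes K: "strictly_convex_body K"
  obtains Y :: "'a \<Rightarrow> 'a"
  where "continuous_on (sphere 0 1) Y"
    and "\<And>u. norm u = 1 \<Longrightarrow> Y u \<in> K - interior K"
    and "\<And>u. norm u = 1 \<Longrightarrow> \<exists>r>0. Y u - Y (- u) = r *\<^sub>R u"
    and "\<And>u x y s. norm u = 1 \<Longrightarrow> x \<in> K \<Longrightarrow> y \<in> K \<Longrightarrow> x - y = s *\<^sub>R u \<Longrightarrow> s \<le> dist (Y u) (Y (- u))"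
proof -
  have K': "convex K" "compact K" "interior K \<noteq> {}"
    and sc: "\<And>x y. x \<in> K \<Longrightarrow> y \<in> K \<Longrightarrow> x \<noteq> y \<Longrightarrow> open_segment x y \<subseteq> interior K"
    using K by (auto simp: strictly_convex_body_def convex_body_def)
  define D where "D = {x - y |x y. x \<in> K \<and> y \<in> K}"
  have "D = (\<Union>x\<in>K. \<Union>y\<in>K. {x - y})" by (auto simp: D_def)
  then have D: "convex D" "compact D" "closed D"
    using convex_differences[OF K'(1,1)] compact_differences'[OF K'(2,2)] compact_imp_closed by auto
  have intD: "x - y \<in> interior D" if "x \<in> interior K" "y \<in> K" for x y
    using interior_differences[OF that] by (simp add: D_def)
  have frD: "frontier D = D - interior D"
    using D(3) by (simp add: frontier_def closure_closed)
  obtain o' where "o' \<in> interior K" using K' by auto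
  then have D0: "0 \<in> interior D"
    using intD[of o' o'] interior_subset by auto
  \<comment> \<open>\<open>E\<close> collects the endpoint pairs of the longest chords and
    \<open>e\<close> reads off their directions. Once \<open>e\<close> is a continuous bijection
    from the compact \<open>E\<close> onto the sphere, its inverse is continuous, so the endpoints
    depend continuously on the direction.\<close>
  define E where "E = {w \<in> K \<times> K. fst w - snd w \<in> frontier D}"
  define e where "e = (\<lambda>w::'a \<times> 'a. sgn (fst w - snd w))"
  have E_ne: "fst w \<noteq> snd w" if "w \<in> E" for w
    using that D0 by (auto simp: E_def frontier_def)
  have "E = (K \<times> K) \<inter> ((\<lambda>w. fst w - snd w) -` frontier D)" by (auto simp: E_def)
  moreover have "closed ((\<lambda>w. fst w - snd w) -` frontier D)"
    by (intro closed_vimage continuous_intros) (auto simp: frontier_closed)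
  ultimately have "compact E" using K' by (auto intro!: compact_Int_closed compact_Times)
  moreover have "continuous_on E e"
    unfolding e_def using E_ne by (intro continuous_intros) auto
  moreover have "e ` E = sphere 0 1"
  proof
    show "e ` E \<subseteq> sphere 0 1" using E_ne by (auto simp: e_def norm_sgn)
    show "sphere 0 1 \<subseteq> e ` E"
    proof
      fix u :: 'a assume u: "u \<in> sphere 0 1"
      then have "u \<noteq> 0" by auto
      then obtain r where r: "r > 0" "0 + r *\<^sub>R u \<in> frontier D"
        using ray_to_frontier[OF compact_imp_bounded[OF D(2)] D0] by blast
      then obtain x y where "x \<in> K" "y \<in> K" "r *\<^sub>R u = x - y"
        using frD by (auto simp: D_def)
      then have "(x, y) \<in> E" "e (x, y) = u"
        using r u by (auto simp: E_def e_def sgn_scaleR simp flip: \<open>r *\<^sub>R u = x - y\<close>)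
          (simp add: sgn_div_norm)
      then show "u \<in> e ` E" by blast
    qed
  qed
  moreover have "inj_on e E"
  proof (rule inj_onI)
    fix v w assume vw: "v \<in> E" "w \<in> E" "e v = e w"
    define u where "u = e v"
    define a b where "a = norm (fst v - snd v)" and "b = norm (fst w - snd w)"
    have ab: "fst v - snd v = a *\<^sub>R u" "a > 0"
      using E_ne[OF vw(1)] by (simp_all add: a_def u_def e_def sgn_div_norm)
    have ab': "fst w - snd w = b *\<^sub>R u" "b > 0"
      using E_ne[OF vw(2)] unfolding u_def vw(3) by (simp_all add: b_def e_def sgn_div_norm)
    note ab = ab ab'
    have "a *\<^sub>R u \<in> frontier D" "b *\<^sub>R u \<in> frontier D"
      using vw by (auto simp: E_def simp flip: ab(1,3))
    then have "a = b"
      using frontier_maximal_on_ray[OF D(1,3) D0, of a u b] frontier_maximal_on_ray[OF D(1,3) D0, of b u a]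
        ab(2,4) frD by auto
    then have diff: "fst v - snd v = fst w - snd w" using ab by simp
    show "v = w"
    \<comment> \<open>Two distinct pairs with the same difference average to a pair with that
      difference whose first entry is interior to \<open>K\<close> by strict convexity. The
      difference would then be interior to \<open>D\<close>.\<close>
    proof (rule ccontr)
      assume "v \<noteq> w"
      then have "fst v \<noteq> fst w" using diff by (auto simp: prod_eq_iff)
      moreover have memb: "fst v \<in> K" "fst w \<in> K" "snd v \<in> K" "snd w \<in> K"
        using vw by (auto simp: E_def)
      ultimately have "midpoint (fst v) (fst w) \<in> interior K"
        using sc midpoint_in_open_segment by blast
      moreover have "midpoint (snd v) (snd w) \<in> K"
        using K'(1) memb by (meson convex_contains_segment midpoints_in_convex_hull midpoint_in_closed_segment subsetD)
      ultimately have "midpoint (fst v) (fst w) - midpoint (snd v) (snd w) \<in> interior D"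
        by (rule intD)
      moreover have "midpoint (fst v) (fst w) - midpoint (snd v) (snd w)
          = (1/2) *\<^sub>R ((fst v - snd v) + (fst w - snd w))"
        by (simp add: midpoint_def algebra_simps)
      moreover have "\<dots> = fst v - snd v" unfolding diff by (simp flip: scaleR_2)
      ultimately show False using vw by (simp add: E_def frontier_def)
    qed
  qed
  ultimately obtain k where k: "homeomorphism E (sphere 0 1) e k"
    using homeomorphism_compact by blast
  have ke: "k (e w) = w" if "w \<in> E" for w using that k by (auto simp: homeomorphism_def)
  have kE: "k u \<in> E" "e (k u) = u" if "norm u = 1" for u
    using that k by (auto simp: homeomorphism_def)
  \<comment> \<open>As \<open>D\<close> is symmetric, swapping the endpoints stays in
    \<open>E\<close> and reverses the direction. So the single function \<open>fst (k u)\<close>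
    provides both ends of each chord.\<close>
  have snd_k: "snd (k u) = fst (k (- u))" if "norm u = 1" for u
  proof -
    have uD: "- z \<in> D" if z: "z \<in> D" for z
    proof -
      obtain x y where "x \<in> K" "y \<in> K" "z = x - y" using z unfolding D_def by blast
      then show ?thesis unfolding D_def by (intro CollectI exI[of _ y] exI[of _ x]) simp
    qed
    then have "uminus ` D = D" by force
    then have "uminus ` interior D = interior D" by (metis interior_negations)
    then have "- z \<in> frontier D" if "z \<in> frontier D" for z
      using that uD frD by force
    then have "prod.swap (k u) \<in> E"
      using kE(1)[OF that] by (force simp: E_def)
    moreover have "e (prod.swap (k u)) = - u"
      using kE(2)[OF that] sgn_minus[of "fst (k u) - snd (k u)"] by (simp add: e_def)
    ultimately show ?thesis using ke by fastforce
  qed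
  show thesis
  proof
    show "continuous_on (sphere 0 1) (\<lambda>u. fst (k u))"
      using k by (intro continuous_intros) (auto simp: homeomorphism_def)
    fix u :: 'a assume u: "norm u = 1"
    have w: "fst (k u) \<in> K" "snd (k u) \<in> K" "fst (k u) - snd (k u) \<in> frontier D"
      using kE[OF u] by (auto simp: E_def)
    then show "fst (k u) \<in> K - interior K"
      using intD[of "fst (k u)" "snd (k u)"] by (auto simp: frontier_def)
    define r where "r = norm (fst (k u) - snd (k u))"
    have "r > 0" "fst (k u) - snd (k u) = r *\<^sub>R e (k u)"
      using E_ne[OF kE(1)[OF u]] by (simp_all add: r_def e_def sgn_div_norm)
    then have r: "r > 0" "fst (k u) - snd (k u) = r *\<^sub>R u"
      unfolding kE(2)[OF u] .
    then show "\<exists>r>0. fst (k u) - fst (k (- u)) = r *\<^sub>R u"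
      using snd_k[OF u] by auto
    fix x y s assume "x \<in> K" "y \<in> K" "x - y = s *\<^sub>R u"
    then have "s *\<^sub>R u \<in> D" by (force simp: D_def)
    then have "s \<le> r"
      using frontier_maximal_on_ray[OF D(1,3) D0 r(1)] r(2) w(3) by auto
    then show "s \<le> dist (fst (k u)) (fst (k (- u)))"
      using snd_k[OF u] by (simp add: r_def dist_norm)
  qed
qed

text \<open>The bound \<open>max\<close> is one-sided in \<open>s\<close>, but exchanging the two
  ends of a chord turns it into a bound on the absolute value, hence on the diameter of every
  parallel section. The line through \<open>z\<close> contains \<open>y\<close> as well and attains
  it.\<close>

lemma affine_diameter_longest_chord:
  fixes K :: "'a::euclidean_space set"
  assumes "compact K" "norm u = 1" "y \<in> K" "z \<in> K" "y - z = r *\<^sub>R u"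
    and max: "\<And>x x' s. x \<in> K \<Longrightarrow> x' \<in> K \<Longrightarrow> x - x' = s *\<^sub>R u \<Longrightarrow> s \<le> dist y z"
  shows "affine_diameter K ((+) z ` span {u})"
proof -
  have "interval_length (K \<inter> (+) v ` span {u}) \<le> dist y z" for v
    unfolding interval_length_def
  proof (rule diameter_le)
    fix p q assume pq: "p \<in> K \<inter> (+) v ` span {u}" "q \<in> K \<inter> (+) v ` span {u}"
    then have "p - q \<in> span {u}" by (auto simp: span_diff)
    then obtain s where s: "p - q = s *\<^sub>R u" by (auto simp: span_singleton)
    then have "q - p = (- s) *\<^sub>R u" by (metis minus_diff_eq scaleR_minus_left)
    then have "s \<le> dist y z" "- s \<le> dist y z" using max pq s by blast+
    then show "norm (p - q) \<le> dist y z" using s assms(2) by simp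
  qed simp
  moreover have "dist y z \<le> interval_length (K \<inter> (+) z ` span {u})"
    unfolding interval_length_def
  proof (rule diameter_bounded_bound)
    show "bounded (K \<inter> (+) z ` span {u})"
      using compact_imp_bounded[OF assms(1)] by (rule bounded_subset) simp
    have "y = z + r *\<^sub>R u" using assms(5) by (simp add: algebra_simps)
    then show "y \<in> K \<inter> (+) z ` span {u}" using assms(3) by (auto simp: span_singleton)
    show "z \<in> K \<inter> (+) z ` span {u}" using assms(4) by (simp add: image_iff span_zero)
  qed
  ultimately have "interval_length (K \<inter> (+) v ` span {u}) \<le> interval_length (K \<inter> (+) z ` span {u})" for v
    using order_trans by blast
  moreover have "span {u} \<in> lines_through_origin"
    using assms(2) by (auto simp: lines_through_origin_eq_image_sphere)
  ultimately show ?thesis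
    unfolding affine_diameter_def affine_diameter_in_direction_def by auto
qed

section \<open>Equality of lines and of their translates\<close>

text \<open>Serves both for the points of the projective space, which are lines in the product with
  the reals, and for the directions of the affine diameters.\<close>

lemma span_singleton_eq_unit_vectors:
  fixes u v :: "'a::real_normed_vector"
  assumes "norm u = 1" "norm v = 1" "span {u} = span {v}"
  shows "u = v \<or> u = - v"
proof -
  have "u \<in> span {v}" using assms(3) by (metis insertI1 span_base)
  then obtain s where "u = s *\<^sub>R v" by (auto simp: span_singleton)
  moreover have "\<bar>s\<bar> = 1" using assms calculation by simp
  ultimately show ?thesis by (auto simp: abs_if split: if_splits)
qed

lemma translation_span_absorb:
  "v \<in> span S \<Longrightarrow> (+) (v + a) ` span S = (+) a ` span S"
proof (intro equalityI subsetI)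
  fix x assume v: "v \<in> span S" and "x \<in> (+) (v + a) ` span S"
  then obtain s where "s \<in> span S" "x = a + (v + s)" by (auto simp: algebra_simps)
  then show "x \<in> (+) a ` span S" using v by (auto intro: span_add)
next
  fix x assume v: "v \<in> span S" and "x \<in> (+) a ` span S"
  then obtain s where s: "s \<in> span S" "x = a + s" by auto
  then have "x = v + a + (s - v)" by simp
  then show "x \<in> (+) (v + a) ` span S" using v s(1) span_diff by blast
qed

section \<open>Continuity of the map on the sphere, in particular at the poles\<close>

text \<open>At \<open>x = 0\<close>, where \<open>sgn x = 0\<close> is not a direction, the value is the pole \<open>(0, 1)\<close>.\<close>

lemma continuous_on_diameter_collapse:
  fixes K :: "'a::euclidean_space set"
  assumes K: "convex K" "compact K"
    and q: "continuous_on K q" "\<And>u. norm u = 1 \<Longrightarrow> q (Y u) = (0, 1)"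
    and Y: "continuous_on (sphere 0 1) Y" "\<And>u. norm u = 1 \<Longrightarrow> Y u \<in> K"
  defines "P \<equiv> \<lambda>w. ((1 + snd w) / 2) *\<^sub>R Y (sgn (fst w)) + ((1 - snd w) / 2) *\<^sub>R Y (- sgn (fst w))"
  shows "continuous_on (sphere 0 1)
           (\<lambda>w::'a \<times> real. if fst w = 0 then (0, 1) else q (P w) :: 'a \<times> real)"
    (is "continuous_on _ ?F")
proof -
  define S where "S = {w \<in> sphere 0 1 :: ('a \<times> real) set. fst w \<noteq> 0}"
  have P: "P w \<in> K" if "w \<in> S" for w
  proof -
    have "\<bar>snd w\<bar> \<le> 1" using that norm_snd_le[of "snd w" "fst w"] by (simp add: S_def)
    then show ?thesis unfolding P_def
      using that by (intro convexD[OF K(1)] Y) (auto simp: S_def norm_sgn field_simps)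
  qed
  have "continuous_on S P"
    unfolding P_def
    by (intro continuous_intros continuous_on_compose2[OF Y(1)]) (auto simp: S_def norm_sgn)
  then have "continuous_on S (\<lambda>w. q (P w))"
    using P by (intro continuous_on_compose2[OF q(1)]) auto
  then have "continuous_on S ?F"
    by (rule continuous_on_eq) (auto simp: S_def)
  have F_S: "continuous (at w within sphere 0 1) ?F" if "w \<in> S" for w
  proof -
    have "open {w::'a \<times> real. fst w \<noteq> 0}"
      by (intro open_Collect_neq continuous_intros)
    moreover have "S = sphere 0 1 \<inter> {w. fst w \<noteq> 0}" by (auto simp: S_def)
    ultimately have S_at: "at w within S = at w within sphere 0 1"
      using that by (intro at_within_nhd[of _ "{w. fst w \<noteq> 0}"]) (auto simp: S_def)
    have "continuous (at w within S) ?F"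
      using \<open>continuous_on S ?F\<close> that unfolding continuous_on_eq_continuous_within by blast
    then show ?thesis unfolding S_at .
  qed
  \<comment> \<open>Near a pole the direction of \<open>fst w'\<close> is uncontrolled and
    \<open>P w'\<close> need not converge. It does approach an end \<open>Y u\<close> of its own
    chord, where \<open>q\<close> is \<open>(0, 1)\<close>, and uniform continuity of
    \<open>q\<close> on \<open>K\<close> treats all directions at once.\<close>
  have F_0: "continuous (at w within sphere 0 1) ?F" if w: "w \<in> sphere 0 1" "fst w = 0" for w
    unfolding continuous_within_eps_delta
  proof (intro allI impI)
    fix \<epsilon> :: real assume "\<epsilon> > 0"
    then obtain d where d: "d > 0" "\<And>x y. x \<in> K \<Longrightarrow> y \<in> K \<Longrightarrow> dist x y < d \<Longrightarrow> dist (q x) (q y) < \<epsilon>"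
      using compact_uniformly_continuous[OF q(1) K(2)] unfolding uniformly_continuous_on_def by metis
    obtain B where B: "B > 0" "\<And>x. x \<in> K \<Longrightarrow> norm x \<le> B"
      using compact_imp_bounded[OF K(2)] by (meson bounded_pos)
    have t: "\<bar>snd w\<bar> = 1" using w by (cases w) (auto simp: norm_Pair power2_eq_1_iff)
    show "\<exists>\<delta>>0. \<forall>w'\<in>sphere 0 1. dist w' w < \<delta> \<longrightarrow> dist (?F w') (?F w) < \<epsilon>"
    \<comment> \<open>Chords of \<open>K\<close> have length at most \<open>2 * B\<close>, and
      moving by \<open>dist w' w\<close> in height covers at most half that fraction of a
      chord.\<close>
    proof (intro exI[of _ "d / B"] conjI ballI impI)
      show "d / B > 0" using d B by simp
      fix w' :: "'a \<times> real" assume w': "w' \<in> sphere 0 1" "dist w' w < d / B"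
      show "dist (?F w') (?F w) < \<epsilon>"
      proof (cases "fst w' = 0")
        case True
        then show ?thesis using w \<open>\<epsilon> > 0\<close> by simp
      next
        case False
        then have "w' \<in> S" using w' by (simp add: S_def)
        \<comment> \<open>\<open>snd w\<close> is 1 or -1 here; this sign selects the end of the
          chord that belongs to the pole \<open>w\<close>.\<close>
        define u where "u = snd w *\<^sub>R sgn (fst w')"
        have u: "norm u = 1" "norm (- u) = 1" using t False by (auto simp: u_def norm_sgn)
        have "P w' - Y u = ((1 - snd w * snd w') / 2) *\<^sub>R (Y (- u) - Y u)"
        proof (cases "snd w = 1")
          case True
          then show ?thesis
            by (simp add: P_def u_def algebra_simps add_divide_distrib diff_divide_distrib)
              (simp flip: scaleR_left_distrib)
        next
          case False
          then have "snd w = - 1" using t by linarith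
          then show ?thesis
            by (simp add: P_def u_def algebra_simps add_divide_distrib diff_divide_distrib)
              (simp flip: scaleR_left_distrib)
        qed
        then have "dist (P w') (Y u) = \<bar>1 - snd w * snd w'\<bar> / 2 * norm (Y (- u) - Y u)"
          by (simp add: dist_norm)
        also have "\<bar>1 - snd w * snd w'\<bar> = \<bar>snd w * (snd w - snd w')\<bar>"
          using t by (simp add: right_diff_distrib) (metis abs_mult_self_eq mult_1)
        also have "\<dots> = dist (snd w') (snd w)" using t by (simp add: abs_mult dist_real_def)
        also have "dist (snd w') (snd w) / 2 * norm (Y (- u) - Y u) \<le> dist w' w / 2 * (B + B)"
          using B(2)[OF Y(2)[OF u(1)]] B(2)[OF Y(2)[OF u(2)]]
          by (intro mult_mono divide_right_mono dist_snd_le order_trans[OF norm_triangle_ineq4] add_mono) auto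
        also have "\<dots> < d" using w'(2) B(1) by (simp add: field_simps)
        finally have "dist (q (P w')) (q (Y u)) < \<epsilon>"
          using d(2) P \<open>w' \<in> S\<close> Y(2) u by blast
        then show ?thesis using False w q(2)[OF u(1)] by simp
      qed
    qed
  qed
  show ?thesis
    unfolding continuous_on_eq_continuous_within
  proof
    fix w :: "'a \<times> real" assume "w \<in> sphere 0 1"
    then show "continuous (at w within sphere 0 1) ?F"
      by (cases "fst w = 0") (use F_S F_0 in \<open>simp_all only: S_def mem_Collect_eq simp_thms\<close>)
  qed
qed

section \<open>The map on projective space and its multiplicities\<close>

theorem theorem1p11:
  fixes K :: "(real ^ 'n) set"
  assumes "strictly_convex_body K"
  shows "\<exists>f :: ((real ^ 'n) \<times> real) set \<Rightarrow> (real ^ 'n) \<times> real.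
           continuous_map real_projective_space (top_of_set (sphere 0 1)) f \<and>
           (\<forall>k\<ge>2. admits_multiplicity real_projective_space f k \<longrightarrow>
              (\<exists>D :: nat \<Rightarrow> (real ^ 'n) set.
                 inj_on D {1..k} \<and>
                 (\<forall>i\<in>{1..k}. affine_diameter K (D i)) \<and>
                 (\<Inter>i\<in>{1..k}. D i) \<inter> interior K \<noteq> {}))"
proof -
  have K: "convex_body K" "convex K" "compact K"
    and sc: "\<And>x y. x \<in> K \<Longrightarrow> y \<in> K \<Longrightarrow> x \<noteq> y \<Longrightarrow> open_segment x y \<subseteq> interior K"
    using assms by (auto simp: strictly_convex_body_def convex_body_def)
  obtain Y where Y_cont: "continuous_on (sphere 0 1) Y"
    and Y: "\<And>u. norm u = 1 \<Longrightarrow> Y u \<in> K - interior K"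
    and Y_dir: "\<And>u. norm u = 1 \<Longrightarrow> \<exists>r>0. Y u - Y (- u) = r *\<^sub>R u"
    and Y_max: "\<And>u x y s. norm u = 1 \<Longrightarrow> x \<in> K \<Longrightarrow> y \<in> K \<Longrightarrow> x - y = s *\<^sub>R u \<Longrightarrow> s \<le> dist (Y u) (Y (- u))"
    using affine_diameter_endpoints[OF assms] by blast
  obtain q :: "real ^ 'n \<Rightarrow> (real ^ 'n) \<times> real" where q: "continuous_on K q" "q ` K \<subseteq> sphere 0 1"
    "inj_on q (interior K)" "\<And>y. y \<in> K \<Longrightarrow> q y = (0, 1) \<longleftrightarrow> y \<notin> interior K"
    using collapse_frontier[OF K(1)] by blast
  \<comment> \<open>A unit vector \<open>w\<close> off the poles stands for a point of the line
    bundle: \<open>fst w\<close> spans the base line and the height \<open>snd w\<close> is the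
    position on its chord, from \<open>Y (- u)\<close> at -1 to \<open>Y u\<close> at 1 for
    \<open>u = sgn (fst w)\<close>. Passing to \<open>- w\<close> exchanges the ends and reverses
    the height, so \<open>P\<close> is even.\<close>
  define P where "P = (\<lambda>w. ((1 + snd w) / 2) *\<^sub>R Y (sgn (fst w)) + ((1 - snd w) / 2) *\<^sub>R Y (- sgn (fst w)))"
  have P_even: "P (- w) = P w" for w
    by (simp add: P_def add.commute sgn_minus)
  have P_affine: "P w = ((1 + snd w) / 2) *\<^sub>R (Y (sgn (fst w)) - Y (- sgn (fst w))) + Y (- sgn (fst w))" for w
  proof -
    have "(1 - snd w) / 2 = 1 - (1 + snd w) / 2" by (simp add: field_simps)
    then show ?thesis unfolding P_def by (simp only: scaleR_diff_left scaleR_diff_right) simp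
  qed
  \<comment> \<open>On a fixed chord the position gives the height, the height gives
    \<open>norm (fst w)\<close> on the unit sphere, and with the direction this gives
    \<open>w\<close>.\<close>
  have P_inj: "v = w"
    if "norm v = 1" "norm w = 1" "fst v \<noteq> 0" "fst w \<noteq> 0" "sgn (fst v) = sgn (fst w)" "P v = P w" for v w
  proof -
    have "norm (sgn (fst w)) = 1" using that by (simp add: norm_sgn)
    then have "Y (sgn (fst w)) - Y (- sgn (fst w)) \<noteq> 0" using Y_dir by force
    then have snd: "snd v = snd w" using that by (simp add: P_affine)
    have "norm (fst z) = sqrt (1 - (snd z)\<^sup>2)" if "norm z = 1" for z :: "(real ^ 'n) \<times> real"
      using that by (cases z) (auto simp: norm_Pair intro!: real_sqrt_unique[symmetric])
    then have "norm (fst v) = norm (fst w)" using that snd by simp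
    then have "fst v = fst w" using that by (simp add: sgn_div_norm)
    then show ?thesis using snd by (simp add: prod_eq_iff)
  qed
  \<comment> \<open>The two poles are antipodal and thus form one point of projective space, the
    point at infinity of the Thom space.\<close>
  define F where "F = (\<lambda>w. if fst w = 0 then (0, 1) else q (P w))"
  have F_cont: "continuous_on (sphere 0 1) F"
    unfolding F_def P_def
    by (rule continuous_on_diameter_collapse) (use K q Y Y_cont in auto)
  have P_int: "P w \<in> interior K" if w: "w \<in> sphere 0 1" "fst w \<noteq> 0" for w
  proof -
    let ?u = "sgn (fst w)"
    have u: "norm ?u = 1" "norm (- ?u) = 1" using w by (auto simp: norm_sgn)
    have "(norm (fst w))\<^sup>2 + (snd w)\<^sup>2 = 1"
      using w(1) by (cases w) (simp add: norm_Pair)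
    then have "(snd w)\<^sup>2 < 1" using w(2) by (smt (verit) zero_less_norm_iff zero_less_power)
    then have t: "- 1 < snd w" "snd w < 1" by (auto simp: abs_square_less_1 abs_less_iff)
    have "Y ?u \<noteq> Y (- ?u)" using Y_dir[OF u(1)] u by auto
    moreover have "P w = (1 - (1 - snd w) / 2) *\<^sub>R Y ?u + ((1 - snd w) / 2) *\<^sub>R Y (- ?u)"
      by (simp add: P_def field_simps)
    ultimately have "P w \<in> open_segment (Y ?u) (Y (- ?u))"
      using t unfolding in_segment by (intro conjI exI[of _ "(1 - snd w) / 2"]) auto
    then show ?thesis using sc Y u \<open>Y ?u \<noteq> Y (- ?u)\<close> by blast
  qed
  have F_sphere: "F ` sphere 0 1 \<subseteq> sphere 0 1"
    using P_int q(2) interior_subset by (fastforce simp: F_def norm_Pair)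
  have F_even: "F (- w) = F w" for w
    by (simp add: F_def P_even)
  have F_span: "F v = F w" if "norm v = 1" "norm w = 1" "span {v} = span {w}" for v w
    using span_singleton_eq_unit_vectors[OF that] F_even by metis
  obtain f where f: "continuous_map real_projective_space (top_of_set (sphere 0 1)) f"
    "\<And>w. norm w = 1 \<Longrightarrow> f (span {w}) = F w"
  proof (rule quotient_map_lift_exists[OF quotient_map_real_projective_space])
    show "continuous_map (top_of_set (sphere 0 1)) (top_of_set (sphere 0 1)) F"
      using F_cont F_sphere by (simp add: continuous_map_in_subtopology image_subset_iff)
    show "F x = F y" if "x \<in> topspace (top_of_set (sphere 0 1))"
      "y \<in> topspace (top_of_set (sphere 0 1))" "span {x} = span {y}" for x y
      using that by (intro F_span) auto
  qed simp
  show ?thesis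
  proof (intro exI[of _ f] conjI f(1) allI impI)
    fix k :: nat assume k: "k \<ge> 2" "admits_multiplicity real_projective_space f k"
    then obtain X where X: "X ` {1..k} \<subseteq> lines_through_origin" "inj_on X {1..k}"
      "\<And>i j. i \<in> {1..k} \<Longrightarrow> j \<in> {1..k} \<Longrightarrow> f (X i) = f (X j)"
      unfolding admits_multiplicity_def topspace_real_projective_space by blast
    have "\<forall>i\<in>{1..k}. \<exists>w. norm w = 1 \<and> X i = span {w}"
    proof
      fix i assume "i \<in> {1..k}"
      then have "X i \<in> (\<lambda>x. span {x}) ` sphere 0 1"
        using X(1) unfolding lines_through_origin_eq_image_sphere by blast
      then show "\<exists>w. norm w = 1 \<and> X i = span {w}" unfolding image_iff sphere_def by (auto simp del: split_paired_Ex)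
    qed
    then obtain w where w: "\<And>i. i \<in> {1..k} \<Longrightarrow> norm (w i) = 1"
      "\<And>i. i \<in> {1..k} \<Longrightarrow> X i = span {w i}"
      by metis
    have F_eq: "F (w i) = F (w j)" if "i \<in> {1..k}" "j \<in> {1..k}" for i j
      using X(3)[OF that] w[OF that(1)] w[OF that(2)] by (simp add: f(2))
    have w_eq: "i = j" if "i \<in> {1..k}" "j \<in> {1..k}" "w i = w j \<or> w i = - w j" for i j
    proof -
      have "span {- w j} = span {w j}"
        unfolding span_eq by simp (metis insertI1 minus_minus span_base span_neg)
      then have "X i = X j" using that w(2) by metis
      then show ?thesis using X(2) that by (auto dest: inj_onD)
    qed
    have F_pole: "F (w i) = (0, 1) \<longleftrightarrow> fst (w i) = 0" if "i \<in> {1..k}" for i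
      using P_int[of "w i"] w(1)[OF that] q(4) interior_subset by (auto simp: F_def)
    \<comment> \<open>\<open>F\<close> takes the value \<open>(0, 1)\<close> only at poles, so one
      pole among the \<open>w i\<close> makes all of them poles. They would all span the same line,
      against \<open>k \<ge> 2\<close> distinct points.\<close>
    have fst_ne: "fst (w i) \<noteq> 0" if i: "i \<in> {1..k}" for i
    proof
      assume "fst (w i) = 0"
      then have 0: "fst (w j) = 0" if "j \<in> {1..k}" for j using F_eq F_pole i that by metis
      then have "\<bar>snd (w j)\<bar> = 1" if "j \<in> {1..k}" for j
        using w(1)[OF that] that by (cases "w j") (force simp: norm_Pair power2_eq_1_iff)
      then have "\<bar>snd (w 1)\<bar> = 1" "\<bar>snd (w 2)\<bar> = 1" using k(1) by auto
      then have "snd (w 1) = snd (w 2) \<or> snd (w 1) = - snd (w 2)" by linarith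
      moreover have "fst (w 1) = 0" "fst (w 2) = 0" using 0 k(1) by auto
      ultimately have "w 1 = w 2 \<or> w 1 = - w 2" by (simp add: prod_eq_iff)
      then show False using w_eq[of 1 2] k(1) by auto
    qed
    define u where "u i = sgn (fst (w i))" for i
    have u: "norm (u i) = 1" "norm (- u i) = 1" if "i \<in> {1..k}" for i
      using fst_ne[OF that] by (auto simp: u_def norm_sgn)
    \<comment> \<open>Injectivity of \<open>q\<close> on the interior turns equal values of
      \<open>F\<close> into one common point of the chords.\<close>
    have P_eq: "P (w i) = P (w j)" if "i \<in> {1..k}" "j \<in> {1..k}" for i j
    proof (rule inj_onD[OF q(3)])
      show "q (P (w i)) = q (P (w j))" using F_eq[OF that] fst_ne that by (simp add: F_def)
    qed (use P_int w(1) fst_ne that in auto)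
    define D where "D i = (+) (P (w 1)) ` span {u i}" for i
    have one: "1 \<in> {1..k}" using k(1) by simp
    \<comment> \<open>Translates by the same vector agree only if the directions agree up to sign.
      If the signs differ, \<open>w j\<close> is replaced by \<open>- w j\<close>, which changes
      neither \<open>P\<close> nor the line spanned.\<close>
    have "inj_on D {1..k}"
    proof (rule inj_onI)
      fix i j assume ij: "i \<in> {1..k}" "j \<in> {1..k}" "D i = D j"
      have "span {u i} = span {u j}"
        using ij(3) inj_image_eq_iff[OF inj_on_add] unfolding D_def by blast
      then consider "u i = u j" | "u i = - u j"
        using span_singleton_eq_unit_vectors u ij by blast
      then have "w i = w j \<or> w i = - w j"
      proof cases
        case 1
        then show ?thesis
          using P_inj[OF w(1) w(1) fst_ne fst_ne _ P_eq] ij by (simp add: u_def)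
      next
        case 2
        then show ?thesis
          using P_inj[of "w i" "- w j"] P_eq[OF ij(1,2)] P_even[of "w j"] w(1)[OF ij(1)] w(1)[OF ij(2)]
            fst_ne[OF ij(1)] fst_ne[OF ij(2)]
          by (simp add: u_def sgn_minus)
      qed
      then show "i = j" by (rule w_eq[OF ij(1,2)])
    qed
    moreover have "affine_diameter K (D i)" if i: "i \<in> {1..k}" for i
    proof -
      obtain r where r: "Y (u i) - Y (- u i) = r *\<^sub>R u i" using Y_dir u i by blast
      \<comment> \<open>The base point slides along the line from the common point to the end
        \<open>Y (- u i)\<close> of the longest chord.\<close>
      then have "P (w i) = ((1 + snd (w i)) / 2 * r) *\<^sub>R u i + Y (- u i)"
        by (simp add: P_affine u_def)
      then have "(+) (P (w i)) ` span {u i} = (+) (Y (- u i)) ` span {u i}"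
        by (simp only: translation_span_absorb span_base span_scale insertI1)
      then have "D i = (+) (Y (- u i)) ` span {u i}"
        using P_eq[OF one i] by (simp add: D_def)
      moreover have "affine_diameter K ((+) (Y (- u i)) ` span {u i})"
      proof (rule affine_diameter_longest_chord[OF K(3) u(1)[OF i] _ _ r])
        show "Y (u i) \<in> K" "Y (- u i) \<in> K" using Y u[OF i] by blast+
      qed (rule Y_max[OF u(1)[OF i]])
      ultimately show ?thesis by simp
    qed
    moreover have "P (w 1) \<in> (\<Inter>i\<in>{1..k}. D i) \<inter> interior K"
    proof
      show "P (w 1) \<in> (\<Inter>i\<in>{1..k}. D i)" by (simp add: D_def image_iff span_zero)
      show "P (w 1) \<in> interior K" using P_int w(1)[OF one] fst_ne[OF one] by simp
    qed
    ultimately show "\<exists>D. inj_on D {1..k} \<and> (\<forall>i\<in>{1..k}. affine_diameter K (D i)) \<and>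
        (\<Inter>i\<in>{1..k}. D i) \<inter> interior K \<noteq> {}"
      by (intro exI[of _ D]) blast
  qed
qed

end
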